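(* Let $\xi\in L^n_{\psi_2}(\Omega)$ be an $n$-dimensional sub-gaussian random vector (coordinates not necessarily independent, not necessarily centered) with $\|\xi\|_{\psi_2}\le K$. Then, for every real $n\times n$ matrix $A$ and every $t\ge 0$, $$\mathbb P\Big(\big|\langle A\xi,\xi\rangle-\mathbb E\langle A\xi,\xi\rangle\big|\ge t\Big)\le 2\exp\Big(-\min\Big\{\frac{t^2}{16C_1^2\|A\|_{tr}^2K^4},\ \frac{t}{4C_1\|A\|_{tr}K^2}\Big\}\Big),$$ where $C_1$ is the universal constant specified in the context.
   Context: $(\Omega,\mathcal F,\mathbb P)$ is a probability space; $\langle\cdot,\cdot\rangle$ and $|\cdot|_2$ are the standard inner product and Euclidean norm on $\mathbb R^n$, and $S^{n-1}=\{\mathbf t\in\mathbb R^n:|\mathbf t|_2=1\}$. For a real random variable $\eta$, $\|\eta\|_{\psi_1}=\inf\{K>0:\ \mathbb E\exp(|\eta|/K)\le 2\}$ and $\|\eta\|_{\psi_2}=\inf\{K>0:\ \mathbb E\exp(\eta^2/K^2)\le 2\}$; $\eta$ is sub-exponential if $\|\eta\|_{\psi_1}<\infty$. For a random vector $\xi$ in $\mathbb R^n$, $\|\xi\|_{\psi_2}=\sup_{\mathbf t\in S^{n-1}}\|\langle\xi,\mathbf t\rangle\|_{\psi_2}=\inf\{K>0:\ \sup_{\mathbf t\in S^{n-1}}\mathbb E\exp(\langle\xi,\mathbf t\rangle^2/K^2)\le 2\}$. $L^n_{\psi_2}(\Omega)$ is the space of $n$-dimensional sub-gaussian random vectors, i.e.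 those with $\|\xi\|_{\psi_2}<\infty$. $\|A\|_{tr}=\mathrm{trace}\big((AA^T)^{1/2}\big)$ is the trace norm of $A$ (the sum of its singular values). $C_1>0$ denotes a fixed universal constant such that every centered sub-exponential random variable $\eta$ satisfies $\mathbb E\exp(t\eta)\le\exp(C_1^2\|\eta\|_{\psi_1}^2t^2)$ for all real $t$ with $|t|\le 1/(C_1\|\eta\|_{\psi_1})$. *)

theory Defs
  imports "HOL-Probability.Probability"
begin

text \<open>
  The norms are \<open>ereal\<close>-valued, so the infimum of the empty set is \<open>\<infinity>\<close>. The expectations inside
  them are nonnegative integrals: the Bochner integral would be 0 on a non-integrable exponential.
\<close>

definition psi1_norm :: "'a measure \<Rightarrow> ('a \<Rightarrow> real) \<Rightarrow> ereal" where
  "psi1_norm M \<eta> =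
     Inf {ereal K | K. 0 < K \<and> (\<integral>\<^sup>+ \<omega>. ennreal (exp (\<bar>\<eta> \<omega>\<bar> / K)) \<partial>M) \<le> 2}"

definition psi2_norm :: "'a measure \<Rightarrow> ('a \<Rightarrow> real) \<Rightarrow> ereal" where
  "psi2_norm M \<eta> =
     Inf {ereal K | K. 0 < K \<and> (\<integral>\<^sup>+ \<omega>. ennreal (exp ((\<eta> \<omega>)\<^sup>2 / K\<^sup>2)) \<partial>M) \<le> 2}"

definition psi2_vec_norm :: "'a measure \<Rightarrow> ('a \<Rightarrow> real ^ 'n) \<Rightarrow> ereal" where
  "psi2_vec_norm M \<xi> = (SUP t\<in>sphere 0 1. psi2_norm M (\<lambda>\<omega>. \<xi> \<omega> \<bullet> t))"

definition L_psi2 :: "'a measure \<Rightarrow> ('a \<Rightarrow> real ^ 'n) set" where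
  "L_psi2 M = {\<xi> \<in> borel_measurable M. psi2_vec_norm M \<xi> < \<infinity>}"

definition sub_exponential :: "'a measure \<Rightarrow> ('a \<Rightarrow> real) \<Rightarrow> bool" where
  "sub_exponential M \<eta> \<longleftrightarrow> \<eta> \<in> borel_measurable M \<and> psi1_norm M \<eta> < \<infinity>"

definition centered :: "'a measure \<Rightarrow> ('a \<Rightarrow> real) \<Rightarrow> bool" where
  "centered M \<eta> \<longleftrightarrow> integrable M \<eta> \<and> integral\<^sup>L M \<eta> = 0"

text \<open>
  The defining property of the universal constant \<open>C\<^sub>1\<close>. HOL cannot quantify over types inside a
  formula, so the probability spaces range over all those with sample points in one type \<open>'a\<close>; a
  constant valid for all probability spaces satisfies this for each \<open>'a\<close>. The division is that of
  \<open>ereal\<close>, where \<open>1 / 0 = \<infinity>\<close>, so that all \<open>t\<close> are admitted if \<open>\<eta>\<close> has norm 0.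
\<close>

definition sub_exponential_mgf_constant :: "'a itself \<Rightarrow> real \<Rightarrow> bool" where
  "sub_exponential_mgf_constant (_ :: 'a itself) C \<longleftrightarrow>
     0 < C \<and>
     (\<forall>(M :: 'a measure) \<eta>. prob_space M \<longrightarrow> sub_exponential M \<eta> \<longrightarrow> centered M \<eta> \<longrightarrow>
        (\<forall>t :: real. ereal \<bar>t\<bar> \<le> 1 / (ereal C * psi1_norm M \<eta>) \<longrightarrow>
           (\<integral>\<^sup>+ \<omega>. ennreal (exp (t * \<eta> \<omega>)) \<partial>M)
             \<le> ennreal (exp (C\<^sup>2 * (real_of_ereal (psi1_norm M \<eta>))\<^sup>2 * t\<^sup>2))))"

definition pos_semidef :: "real ^ 'n ^ 'n \<Rightarrow> bool" where
  "pos_semidef B \<longleftrightarrow> transpose B = B \<and> (\<forall>x. 0 \<le> (B *v x) \<bullet> x)"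

text \<open>Meaningful for positive semidefinite \<open>B\<close>, where such a root exists and is unique.\<close>

definition matrix_sqrt :: "real ^ 'n ^ 'n \<Rightarrow> real ^ 'n ^ 'n" where
  "matrix_sqrt B = (THE S. pos_semidef S \<and> S ** S = B)"

definition trace_norm :: "real ^ 'n ^ 'n \<Rightarrow> real" where
  "trace_norm A = trace (matrix_sqrt (A ** transpose A))"

text \<open>
  With \<open>ereal\<close> division, \<open>s / 0 = \<infinity>\<close> for \<open>s > 0\<close> and \<open>0 / 0 = 0\<close>. A tail bound
  \<open>2 exp (- s / 0)\<close> with \<open>s > 0\<close> thus reads as 0, whereas real division would turn it into 2.
\<close>

fun exp_ereal :: "ereal \<Rightarrow> ereal" where
  "exp_ereal (ereal r) = ereal (exp r)"
| "exp_ereal PInfty = \<infinity>"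
| "exp_ereal MInfty = 0"

end

theory Submission
  imports Defs
begin

text \<open>
  Let \<open>W\<close> be an orthonormal eigenbasis of \<open>A A\<^sup>T\<close>. Expanding \<open>x\<close> in \<open>W\<close> gives
  \<open>\<langle>A x, x\<rangle> = \<Sum>w\<in>W. \<langle>x, w\<rangle> \<langle>x, A\<^sup>T w\<rangle> = \<Sum>w\<in>W. s\<^sub>w \<langle>x, w\<rangle> \<langle>x, v\<^sub>w\<rangle>\<close> with \<open>s\<^sub>w = |A\<^sup>T w|\<close> and
  unit vectors \<open>v\<^sub>w\<close>, and \<open>\<Sum>w\<in>W. s\<^sub>w\<close> is the trace norm, because \<open>(A A\<^sup>T)\<^bsup>1/2\<^esup>\<close> acts on \<open>w\<close> as
  multiplication by \<open>s\<^sub>w\<close> (\<open>trace_norm_bilinear_decomposition\<close>). The quadratic form of \<open>\<xi>\<close> is thus a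
  combination, with total weight the trace norm, of products of two marginals of \<open>\<xi>\<close>, each of
  \<open>\<psi>\<^sub>2\<close> norm at most \<open>K\<close>. Since \<open>|a b| \<le> (a\<^sup>2 + b\<^sup>2) / 2\<close> and \<open>exp\<close> is convex, its \<open>\<psi>\<^sub>1\<close> norm is at
  most the trace norm times \<open>K\<^sup>2\<close>. Subtracting the mean at most doubles the
  \<open>\<psi>\<^sub>1\<close> norm, so the centered form has \<open>\<psi>\<^sub>1\<close> norm at most \<open>B = 2 \<parallel>A\<parallel>\<^sub>t\<^sub>r K\<^sup>2\<close> (\<open>psi1_norm_centered_quadratic_form\<close>).

  The defining property of \<open>C\<^sub>1\<close> now bounds the moment generating function near 0, and Chernoff's
  method yields the mixed tail (\<open>sub_exponential_tail\<close>): the exponent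
  \<open>C\<^sub>1\<^sup>2 B\<^sup>2 \<lambda>\<^sup>2 - \<lambda> t\<close> is minimized over \<open>0 < \<lambda> \<le> 1 / (C\<^sub>1 B)\<close>, and the two terms of the minimum in the
  theorem are the cases of an interior minimizer and of the right endpoint.
\<close>

section \<open>Spectral theorem for self-adjoint maps\<close>

text \<open>
  A quadratic polynomial that vanishes at 0 and is nonnegative everywhere has its minimum there, so
  its derivative at 0 is zero.
\<close>

lemma linear_coefficient_zero_if_nonneg:
  fixes b c :: real
  assumes nonneg: "\<And>s. 0 \<le> s * b + s\<^sup>2 * c" and "0 \<le> c"
  shows "b = 0"
proof -
  \<comment> \<open>The denominator \<open>c + 1\<close> instead of the optimal \<open>2 c\<close> covers \<open>c = 0\<close> as well.\<close>
  define r where "r = b / (c + 1)"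
  have "b = r * (c + 1)" using \<open>0 \<le> c\<close> by (simp add: r_def)
  then have "(- r) * b + (- r)\<^sup>2 * c = - r\<^sup>2"
    by (simp add: algebra_simps power2_eq_square)
  with nonneg[of "- r"] have "r\<^sup>2 \<le> 0" by linarith
  then have "r = 0" by simp
  with \<open>b = r * (c + 1)\<close> show ?thesis by simp
qed

text \<open>
  A maximizer \<open>x\<close> of \<open>\<langle>f x, x\<rangle>\<close> on the unit sphere of \<open>V\<close>, with maximum \<open>m\<close>, is an eigenvector:
  the form \<open>g z = m |z|\<^sup>2 - \<langle>f z, z\<rangle>\<close> is nonnegative on \<open>V\<close> and zero at \<open>x\<close>, so its derivative at \<open>x\<close>
  vanishes in the direction \<open>m x - f x\<close>, and this derivative is \<open>2 |m x - f x|\<^sup>2\<close>.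
\<close>

lemma self_adjoint_has_eigenvector:
  fixes f :: "'v::euclidean_space \<Rightarrow> 'v"
  assumes lin: "linear f" and adj: "\<And>x y. f x \<bullet> y = x \<bullet> f y"
    and V: "subspace V" and inv: "f ` V \<subseteq> V" and "V \<noteq> {0}"
  obtains x m where "x \<in> V" "norm x = 1" "f x = m *\<^sub>R x"
proof -
  interpret f: linear f by (fact lin)
  obtain z where z: "z \<in> V" "z \<noteq> 0"
    using \<open>V \<noteq> {0}\<close> subspace_0[OF V] by blast
  have "(1 / norm z) *\<^sub>R z \<in> V \<inter> sphere 0 1"
    using z V by (auto simp: subspace_scale)
  then have ne: "V \<inter> sphere 0 1 \<noteq> {}" by blast
  have "compact (V \<inter> sphere 0 1)"
    using closed_subspace[OF V] by (intro closed_Int_compact) auto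
  moreover have "continuous_on (V \<inter> sphere 0 1) (\<lambda>x. f x \<bullet> x)"
    by (intro continuous_on_inner linear_continuous_on continuous_on_id)
       (use lin linear_conv_bounded_linear in blast)
  ultimately obtain x where x: "x \<in> V" "norm x = 1"
    and max: "\<And>y. y \<in> V \<Longrightarrow> norm y = 1 \<Longrightarrow> f y \<bullet> y \<le> f x \<bullet> x"
    using continuous_attains_sup[OF _ ne, of "\<lambda>x. f x \<bullet> x"] by auto
  define m where "m = f x \<bullet> x"
  define g where "g = (\<lambda>z. m * (z \<bullet> z) - f z \<bullet> z)"
  have g_nonneg: "0 \<le> g z" if "z \<in> V" for z
  proof (cases "z = 0")
    case False
    have "f ((1 / norm z) *\<^sub>R z) \<bullet> ((1 / norm z) *\<^sub>R z) \<le> m"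
      unfolding m_def using that False by (intro max) (auto simp: subspace_scale[OF V])
    then have "f z \<bullet> z / (norm z)\<^sup>2 \<le> m"
      by (simp add: f.scaleR power2_eq_square)
    then show ?thesis
      using False by (simp add: g_def divide_le_eq flip: power2_norm_eq_inner)
  qed (simp add: g_def f.zero)
  define y where "y = m *\<^sub>R x - f x"
  have "y \<in> V"
    unfolding y_def using x inv V by (auto intro!: subspace_diff subspace_scale)
  have xx: "x \<bullet> x = 1" using x by (simp add: norm_eq_1)
  have "g (x + s *\<^sub>R y) = s * (2 * (y \<bullet> y)) + s\<^sup>2 * g y" for s
  proof -
    have "f y \<bullet> x = f x \<bullet> y" by (metis adj inner_commute)
    then have "g (x + s *\<^sub>R y) = s * (2 * (m * (x \<bullet> y) - f x \<bullet> y)) + s\<^sup>2 * g y"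
      unfolding g_def
      by (simp add: f.add f.scaleR inner_add_left inner_add_right xx inner_commute[of y x]
          power2_eq_square algebra_simps flip: m_def)
    also have "m * (x \<bullet> y) - f x \<bullet> y = y \<bullet> y"
      by (simp add: y_def inner_diff_left)
    finally show ?thesis .
  qed
  then have "2 * (y \<bullet> y) = 0"
    using linear_coefficient_zero_if_nonneg[of "2 * (y \<bullet> y)" "g y"] g_nonneg x(1) \<open>y \<in> V\<close> V
    by (metis subspace_add subspace_scale)
  then have "f x = m *\<^sub>R x" by (simp add: y_def)
  with x show ?thesis by (rule that)
qed

text \<open>
  The induction splits off a unit eigenvector \<open>x\<close> and passes to its orthogonal complement in \<open>V\<close>,
  which \<open>f\<close> leaves invariant because it is self-adjoint. Invariant subspaces, not just the whole
  space, are treated so that the induction goes through.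
\<close>

lemma self_adjoint_orthonormal_eigenbasis:
  fixes f :: "'v::euclidean_space \<Rightarrow> 'v"
  assumes lin: "linear f" and adj: "\<And>x y. f x \<bullet> y = x \<bullet> f y"
    and "subspace V" and "f ` V \<subseteq> V"
  shows "\<exists>W. finite W \<and> pairwise orthogonal W \<and> (\<forall>w\<in>W. norm w = 1 \<and> (\<exists>m. f w = m *\<^sub>R w))
           \<and> span W = V"
  using assms(3,4)
proof (induction "dim V" arbitrary: V rule: less_induct)
  case less
  show ?case
  proof (cases "V = {0}")
    case True
    then show ?thesis by (intro exI[of _ "{}"]) auto
  next
    case False
    obtain x m where x: "x \<in> V" "norm x = 1" "f x = m *\<^sub>R x"
      using self_adjoint_has_eigenvector[OF lin adj less.prems False] by blast
    define V' where "V' = {y \<in> V. x \<bullet> y = 0}"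
    have sub: "subspace V'"
      using less.prems(1) unfolding V'_def subspace_def by (auto simp: inner_add_right)
    have inv: "f ` V' \<subseteq> V'"
    proof
      fix z assume "z \<in> f ` V'"
      then obtain y where y: "z = f y" "y \<in> V" "x \<bullet> y = 0" by (auto simp: V'_def)
      then have "x \<bullet> z = 0" using adj[of x y] x(3) by simp
      then show "z \<in> V'" using y less.prems(2) by (auto simp: V'_def)
    qed
    have "x \<notin> V'" using x(2) by (auto simp: V'_def)
    moreover have "V' \<subseteq> V" by (auto simp: V'_def)
    ultimately have "V' \<subset> V" using x(1) by blast
    then have "dim V' < dim V"
      using sub less.prems(1) by (intro dim_psubset) (simp add: span_eq_iff[THEN iffD2])
    from less.hyps[OF this sub inv] obtain W where W: "finite W" "pairwise orthogonal W"
      "\<forall>w\<in>W. norm w = 1 \<and> (\<exists>m. f w = m *\<^sub>R w)" "span W = V'" by blast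
    have WV': "W \<subseteq> V'" using W(4) span_superset by blast
    have "span (insert x W) = V"
    proof
      show "span (insert x W) \<subseteq> V"
        using x(1) WV' less.prems(1) by (intro span_minimal) (auto simp: V'_def)
      show "V \<subseteq> span (insert x W)"
      proof
        fix y assume "y \<in> V"
        then have "y - (x \<bullet> y) *\<^sub>R x \<in> V'"
          using x less.prems(1)
          by (auto simp: V'_def inner_diff_right norm_eq_1 subspace_diff subspace_scale)
        then show "y \<in> span (insert x W)"
          unfolding span_insert W(4) by blast
      qed
    qed
    moreover have "pairwise orthogonal (insert x W)"
      using W(2) WV' by (auto simp: pairwise_insert V'_def orthogonal_def inner_commute)
    ultimately show ?thesis
      using W(1,3) x by (intro exI[of _ "insert x W"]) auto
  qed
qed

section \<open>The trace norm\<close>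

text \<open>
  With \<open>y = S w - s w\<close>, the factorization \<open>(S + s) (S - s) w = 0\<close> says \<open>S y = - s y\<close>. As \<open>S\<close> has no
  negative eigenvalue, \<open>y = 0\<close> if \<open>s > 0\<close>. For \<open>s = 0\<close>, \<open>|S w|\<^sup>2 = \<langle>w, S\<^sup>2 w\<rangle> = 0\<close>. This is what makes
  the positive semidefinite square root unique.
\<close>

lemma pos_semidef_sqrt_eigenvector:
  fixes S :: "real ^ 'n ^ 'n"
  assumes S: "pos_semidef S" and eig: "(S ** S) *v w = s\<^sup>2 *\<^sub>R w" and "0 \<le> s"
  shows "S *v w = s *\<^sub>R w"
proof -
  define y where "y = S *v w - s *\<^sub>R w"
  have SSw: "S *v (S *v w) = s\<^sup>2 *\<^sub>R w"
    using eig by (simp add: matrix_vector_mul_assoc)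
  have adj: "(S *v a) \<bullet> b = a \<bullet> (S *v b)" for a b
    using S by (metis pos_semidef_def dot_lmul_matrix vector_transpose_matrix)
  have "S *v y = - s *\<^sub>R y"
    by (simp add: y_def matrix_vector_mult_diff_distrib matrix_vector_mult_scaleR SSw
        power2_eq_square algebra_simps)
  moreover have "0 \<le> (S *v y) \<bullet> y" using S by (simp add: pos_semidef_def)
  ultimately have "s * (y \<bullet> y) \<le> 0" by simp
  show ?thesis
  proof (cases "s = 0")
    case True
    have "(S *v w) \<bullet> (S *v w) = w \<bullet> (S *v (S *v w))" by (rule adj)
    also have "\<dots> = 0" using SSw True by simp
    finally show ?thesis using True by simp
  next
    case False
    with \<open>s * (y \<bullet> y) \<le> 0\<close> \<open>0 \<le> s\<close> have "y \<bullet> y \<le> 0"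
      by (simp add: mult_le_0_iff)
    then have "y = 0" by (metis inner_ge_zero inner_eq_zero_iff order_antisym)
    then show ?thesis by (simp add: y_def)
  qed
qed

text \<open>
  The square root of \<open>A A\<^sup>T\<close> is \<open>\<Sum>w\<in>W. |A\<^sup>T w| w w\<^sup>T\<close> for an orthonormal eigenbasis \<open>W\<close>, since
  \<open>A A\<^sup>T w = |A\<^sup>T w|\<^sup>2 w\<close>; each \<open>w w\<^sup>T\<close> has trace \<open>|w|\<^sup>2 = 1\<close>.
\<close>

lemma trace_norm_eigenbasis:
  fixes A :: "real ^ 'n ^ 'n"
  obtains W where "finite W" "pairwise orthogonal W" "\<And>w. w \<in> W \<Longrightarrow> norm w = 1"
    "span W = UNIV" "trace_norm A = (\<Sum>w\<in>W. norm (transpose A *v w))"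
proof -
  define B where "B = A ** transpose A"
  have adjA: "(A *v x) \<bullet> y = x \<bullet> (transpose A *v y)" for x y
    by (metis dot_lmul_matrix transpose_matrix_vector inner_commute)
  have B_apply: "B *v x = A *v (transpose A *v x)" for x
    by (simp only: B_def matrix_vector_mul_assoc)
  have Bxy: "(B *v x) \<bullet> y = (transpose A *v x) \<bullet> (transpose A *v y)" for x y
    by (simp add: B_apply adjA)
  have "\<exists>W. finite W \<and> pairwise orthogonal W \<and> (\<forall>w\<in>W. norm w = 1 \<and> (\<exists>m. B *v w = m *\<^sub>R w))
           \<and> span W = UNIV"
  proof (rule self_adjoint_orthonormal_eigenbasis)
    show "(B *v x) \<bullet> y = x \<bullet> (B *v y)" for x y by (metis Bxy inner_commute)
  qed auto
  then obtain W where W: "finite W" "pairwise orthogonal W" "\<And>w. w \<in> W \<Longrightarrow> norm w = 1"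
    "\<And>w. w \<in> W \<Longrightarrow> \<exists>m. B *v w = m *\<^sub>R w" "span W = UNIV" by blast
  define s where "s w = norm (transpose A *v w)" for w
  have eig: "B *v w = (s w)\<^sup>2 *\<^sub>R w" if w: "w \<in> W" for w
  proof -
    obtain m where m: "B *v w = m *\<^sub>R w" using W(4)[OF w] by blast
    have "(s w)\<^sup>2 = (B *v w) \<bullet> w" by (simp add: s_def Bxy power2_norm_eq_inner)
    also have "\<dots> = m" using W(3)[OF w] by (simp add: m norm_eq_1)
    finally show ?thesis using m by simp
  qed
  define R :: "real ^ 'n ^ 'n" where "R = (\<chi> i j. \<Sum>w\<in>W. s w * (w $ i * w $ j))"
  have R_apply: "R *v x = (\<Sum>w\<in>W. (s w * (w \<bullet> x)) *\<^sub>R w)" for x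
  proof (subst vec_eq_iff, rule allI)
    fix i
    have "(R *v x) $ i = (\<Sum>j\<in>UNIV. \<Sum>w\<in>W. s w * (w $ i * w $ j) * x $ j)"
      by (simp add: R_def matrix_vector_mult_def sum_distrib_right)
    also have "\<dots> = (\<Sum>w\<in>W. \<Sum>j\<in>UNIV. s w * (w $ i * w $ j) * x $ j)" by (rule sum.swap)
    also have "\<dots> = (\<Sum>w\<in>W. (s w * (w \<bullet> x)) *\<^sub>R w) $ i"
      by (simp add: inner_vec_def sum_distrib_left sum_distrib_right mult_ac)
    finally show "(R *v x) $ i = (\<Sum>w\<in>W. (s w * (w \<bullet> x)) *\<^sub>R w) $ i" .
  qed
  have R_psd: "pos_semidef R"
    unfolding pos_semidef_def
  proof (intro conjI allI)
    show "transpose R = R" by (simp add: R_def transpose_def vec_eq_iff mult_ac)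
    show "0 \<le> (R *v x) \<bullet> x" for x
      by (simp add: R_apply inner_sum_left s_def sum_nonneg mult.assoc)
  qed
  have R_eig: "R *v w = s w *\<^sub>R w" if "w \<in> W" for w
  proof -
    have "R *v w = (\<Sum>v\<in>W. if v = w then s w *\<^sub>R w else 0)"
      unfolding R_apply using W(2,3) that
      by (intro sum.cong) (auto simp: pairwise_def orthogonal_def norm_eq_1)
    then show ?thesis using W(1) that by simp
  qed
  have matrix_eqI: "P = Q" if "\<And>w. w \<in> W \<Longrightarrow> P *v w = Q *v w" for P Q :: "real ^ 'n ^ 'n"
  proof -
    have "P *v x = Q *v x" for x
      by (rule linear_eq_on_span[of "\<lambda>x. P *v x" "\<lambda>x. Q *v x" W]) (use that W(5) in auto)
    then show ?thesis by (simp add: matrix_eq)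
  qed
  have RR: "R ** R = B"
    by (rule matrix_eqI)
       (simp add: eig R_eig matrix_vector_mult_scaleR power2_eq_square flip: matrix_vector_mul_assoc)
  have "matrix_sqrt B = R"
    unfolding matrix_sqrt_def
  proof (rule the_equality)
    fix S assume S: "pos_semidef S \<and> S ** S = B"
    show "S = R"
    proof (rule matrix_eqI)
      fix w assume w: "w \<in> W"
      have "(S ** S) *v w = (s w)\<^sup>2 *\<^sub>R w" using S eig[OF w] by simp
      then have "S *v w = s w *\<^sub>R w"
        using S pos_semidef_sqrt_eigenvector[of S w "s w"] by (metis norm_ge_zero s_def)
      then show "S *v w = R *v w" by (simp only: R_eig[OF w])
    qed
  qed (use R_psd RR in simp)
  then have "trace_norm A = (\<Sum>i\<in>UNIV. \<Sum>w\<in>W. s w * (w $ i * w $ i))"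
    by (simp add: trace_norm_def trace_def R_def flip: B_def)
  also have "\<dots> = (\<Sum>w\<in>W. \<Sum>i\<in>UNIV. s w * (w $ i * w $ i))" by (rule sum.swap)
  also have "\<dots> = (\<Sum>w\<in>W. s w * (w \<bullet> w))"
    by (simp add: inner_vec_def sum_distrib_left)
  also have "\<dots> = (\<Sum>w\<in>W. norm (transpose A *v w))"
    using W(3) by (intro sum.cong) (auto simp: s_def norm_eq_1)
  finally show ?thesis using W(1,2,3,5) by (intro that[of W]) auto
qed

text \<open>
  This replaces the singular value decomposition: \<open>v w\<close> is the direction of \<open>A\<^sup>T w\<close>, an arbitrary unit
  vector where \<open>A\<^sup>T w = 0\<close>. The \<open>v w\<close> with \<open>s w \<noteq> 0\<close> are in fact the other singular vectors, but only
  their length matters for bounding the summands.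
\<close>

lemma trace_norm_bilinear_decomposition:
  fixes A :: "real ^ 'n ^ 'n"
  obtains W :: "(real ^ 'n) set" and s v
  where "finite W" "\<And>w. w \<in> W \<Longrightarrow> norm w = 1" "\<And>w. norm (v w) = 1" "\<And>w. 0 \<le> s w"
    "trace_norm A = (\<Sum>w\<in>W. s w)" "\<And>x. (A *v x) \<bullet> x = (\<Sum>w\<in>W. s w * ((x \<bullet> w) * (x \<bullet> v w)))"
proof -
  obtain W where W: "finite W" "pairwise orthogonal W" "\<And>w. w \<in> W \<Longrightarrow> norm w = 1"
    "span W = UNIV" "trace_norm A = (\<Sum>w\<in>W. norm (transpose A *v w))"
    using trace_norm_eigenbasis[of A] by blast
  have "\<exists>u. norm u = 1 \<and> norm y *\<^sub>R u = y" for y :: "real ^ 'n"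
  proof (cases "y = 0")
    case True
    then show ?thesis by (metis norm_axis_1 norm_zero scaleR_zero_left)
  next
    case False
    then show ?thesis by (intro exI[of _ "(1 / norm y) *\<^sub>R y"]) simp
  qed
  then obtain u where u: "\<And>y :: real ^ 'n. norm (u y) = 1" "\<And>y. norm y *\<^sub>R u y = y" by metis
  have dec: "(A *v x) \<bullet> x = (\<Sum>w\<in>W. norm (transpose A *v w) * ((x \<bullet> w) * (x \<bullet> u (transpose A *v w))))" for x
  proof -
    have "(A *v x) \<bullet> x = (A *v x) \<bullet> (\<Sum>w\<in>W. (x \<bullet> w) *\<^sub>R w)"
      using W by (subst orthonormal_basis_expand) auto
    also have "\<dots> = (\<Sum>w\<in>W. (x \<bullet> w) * (x \<bullet> (transpose A *v w)))"
      by (simp add: inner_sum_right) (metis dot_lmul_matrix inner_commute)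
    also have "\<dots> = (\<Sum>w\<in>W. norm (transpose A *v w) * ((x \<bullet> w) * (x \<bullet> u (transpose A *v w))))"
      by (subst u(2)[symmetric]) (simp add: mult_ac)
    finally show ?thesis .
  qed
  show ?thesis
    by (rule that[of W "\<lambda>w. u (transpose A *v w)" "\<lambda>w. norm (transpose A *v w)"])
       (use W u dec in auto)
qed

section \<open>Orlicz norms\<close>

lemma psi1_norm_nonneg: "0 \<le> psi1_norm M \<eta>"
  unfolding psi1_norm_def by (intro Inf_greatest) auto

lemma psi1_norm_leI:
  assumes "0 < L" "(\<integral>\<^sup>+ \<omega>. ennreal (exp (\<bar>\<eta> \<omega>\<bar> / L)) \<partial>M) \<le> 2"
  shows "psi1_norm M \<eta> \<le> ereal L"
  unfolding psi1_norm_def using assms by (intro Inf_lower) auto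

text \<open>
  A strict bound avoids the question whether the infimum in the norm is attained; it also forces
  \<open>L > 0\<close>.
\<close>

lemma psi2_norm_lessD:
  assumes "psi2_norm M \<eta> < ereal L"
  shows "0 < L" "(\<integral>\<^sup>+ \<omega>. ennreal (exp ((\<eta> \<omega>)\<^sup>2 / L\<^sup>2)) \<partial>M) \<le> 2"
proof -
  from assms obtain K where K: "0 < K" "K < L" "(\<integral>\<^sup>+ \<omega>. ennreal (exp ((\<eta> \<omega>)\<^sup>2 / K\<^sup>2)) \<partial>M) \<le> 2"
    unfolding psi2_norm_def Inf_less_iff by auto
  then show "0 < L" by simp
  have "K\<^sup>2 \<le> L\<^sup>2" using K by (intro power_mono) auto
  then have "(\<integral>\<^sup>+ \<omega>. ennreal (exp ((\<eta> \<omega>)\<^sup>2 / L\<^sup>2)) \<partial>M) \<le> (\<integral>\<^sup>+ \<omega>. ennreal (exp ((\<eta> \<omega>)\<^sup>2 / K\<^sup>2)) \<partial>M)"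
    using K by (intro nn_integral_mono ennreal_leI) (auto intro!: divide_left_mono)
  also note K(3)
  finally show "(\<integral>\<^sup>+ \<omega>. ennreal (exp ((\<eta> \<omega>)\<^sup>2 / L\<^sup>2)) \<partial>M) \<le> 2" .
qed

lemma psi2_vec_norm_lessD:
  fixes \<xi> :: "'a \<Rightarrow> real ^ 'n"
  assumes "psi2_vec_norm M \<xi> < ereal L" and "norm u = 1"
  shows "0 < L" "(\<integral>\<^sup>+ \<omega>. ennreal (exp ((\<xi> \<omega> \<bullet> u)\<^sup>2 / L\<^sup>2)) \<partial>M) \<le> 2"
proof -
  have "psi2_norm M (\<lambda>\<omega>. \<xi> \<omega> \<bullet> u) \<le> psi2_vec_norm M \<xi>"
    unfolding psi2_vec_norm_def using assms(2) by (intro SUP_upper) auto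
  also note assms(1)
  finally have "psi2_norm M (\<lambda>\<omega>. \<xi> \<omega> \<bullet> u) < ereal L" .
  from psi2_norm_lessD[OF this]
  show "0 < L" "(\<integral>\<^sup>+ \<omega>. ennreal (exp ((\<xi> \<omega> \<bullet> u)\<^sup>2 / L\<^sup>2)) \<partial>M) \<le> 2" by auto
qed

lemma integral_le_if_nn_integral_le:
  fixes f :: "'a \<Rightarrow> real"
  assumes [measurable]: "f \<in> borel_measurable M" and nonneg: "\<And>x. 0 \<le> f x"
    and le: "(\<integral>\<^sup>+ x. ennreal (f x) \<partial>M) \<le> ennreal c" and "0 \<le> c"
  shows "integrable M f" "integral\<^sup>L M f \<le> c"
proof -
  have "(\<integral>\<^sup>+ x. ennreal (f x) \<partial>M) < \<infinity>"
    using le by (rule order_le_less_trans) simp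
  then show int: "integrable M f"
    using nonneg by (intro integrableI_nonneg) auto
  show "integral\<^sup>L M f \<le> c"
    using le nonneg \<open>0 \<le> c\<close> by (simp add: nn_integral_eq_integral[OF int])
qed

text \<open>
  Jensen's inequality with the missing mass \<open>1 - sum q I\<close> placed at the point 0, proved by averaging
  the tangent line inequality for \<open>exp\<close> at the mean.
\<close>

lemma exp_subconvex_combination_le:
  fixes q x :: "'i \<Rightarrow> real"
  assumes "\<And>i. i \<in> I \<Longrightarrow> 0 \<le> q i" and "sum q I \<le> 1"
  shows "exp (\<Sum>i\<in>I. q i * x i) \<le> (\<Sum>i\<in>I. q i * exp (x i)) + (1 - sum q I)"
proof -
  define y where "y = (\<Sum>i\<in>I. q i * x i)"
  have tangent: "exp y * (1 + (z - y)) \<le> exp z" for z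
    using mult_left_mono[OF exp_ge_add_one_self[of "z - y"], of "exp y"]
    by (simp flip: exp_add)
  have "exp y = (\<Sum>i\<in>I. q i * (exp y * (1 + (x i - y)))) + (1 - sum q I) * (exp y * (1 + (0 - y)))"
  proof -
    have "(\<Sum>i\<in>I. q i * (exp y * (1 + (x i - y)))) = exp y * ((1 - y) * sum q I + y)"
    proof -
      have "(\<Sum>i\<in>I. q i * (exp y * (1 + (x i - y))))
          = (\<Sum>i\<in>I. exp y * (1 - y) * q i + exp y * (q i * x i))"
        by (simp add: algebra_simps)
      also have "\<dots> = exp y * (1 - y) * sum q I + exp y * y"
        by (simp add: sum.distrib y_def flip: sum_distrib_left)
      finally show ?thesis by (simp add: algebra_simps)
    qed
    then show ?thesis by (simp add: algebra_simps)
  qed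
  also have "\<dots> \<le> (\<Sum>i\<in>I. q i * exp (x i)) + (1 - sum q I) * exp 0"
    using assms by (intro add_mono sum_mono mult_left_mono tangent) auto
  finally show ?thesis by (simp add: y_def)
qed

text \<open>
  The product of two variables of \<open>\<psi>\<^sub>2\<close> norm at most \<open>k\<close> has \<open>\<psi>\<^sub>1\<close> norm at most \<open>k\<^sup>2\<close>, by
  \<open>|a b| \<le> (a\<^sup>2 + b\<^sup>2) / 2\<close> and convexity of \<open>exp\<close>; the triangle inequality for the \<open>\<psi>\<^sub>1\<close> norm handles the
  sum. Both steps are done at once pointwise. Allowing \<open>L\<close> to exceed \<open>sum s I * k\<^sup>2\<close> makes the weights
  \<open>q\<close> sum to at most 1 and so includes the case that all \<open>s i\<close> are 0.
\<close>

lemma (in prob_space) sum_of_products_psi1_bound: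
  fixes a b :: "'i \<Rightarrow> 'a \<Rightarrow> real"
  assumes "finite I" and s: "\<And>i. i \<in> I \<Longrightarrow> 0 \<le> s i"
    and [measurable]: "\<And>i. i \<in> I \<Longrightarrow> a i \<in> borel_measurable M"
                      "\<And>i. i \<in> I \<Longrightarrow> b i \<in> borel_measurable M"
    and a: "\<And>i. i \<in> I \<Longrightarrow> (\<integral>\<^sup>+ \<omega>. ennreal (exp ((a i \<omega>)\<^sup>2 / k\<^sup>2)) \<partial>M) \<le> 2"
    and b: "\<And>i. i \<in> I \<Longrightarrow> (\<integral>\<^sup>+ \<omega>. ennreal (exp ((b i \<omega>)\<^sup>2 / k\<^sup>2)) \<partial>M) \<le> 2"
    and "0 < k" "0 < L" and L: "sum s I * k\<^sup>2 \<le> L"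
  shows "(\<integral>\<^sup>+ \<omega>. ennreal (exp (\<bar>\<Sum>i\<in>I. s i * (a i \<omega> * b i \<omega>)\<bar> / L)) \<partial>M) \<le> 2"
proof -
  define q where "q i = s i * k\<^sup>2 / L" for i
  define F where "F i \<omega> = (exp ((a i \<omega>)\<^sup>2 / k\<^sup>2) + exp ((b i \<omega>)\<^sup>2 / k\<^sup>2)) / 2" for i \<omega>
  have q: "0 \<le> q i" if "i \<in> I" for i
    using s[OF that] \<open>0 < L\<close> by (simp add: q_def)
  have q1: "sum q I \<le> 1"
    using L \<open>0 < L\<close> by (simp add: q_def flip: sum_distrib_right sum_divide_distrib)
  have F: "integrable M (F i)" "integral\<^sup>L M (F i) \<le> 2" if i: "i \<in> I" for i
  proof -
    note [measurable] = assms(3,4)[OF i]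
    have ai: "integrable M (\<lambda>\<omega>. exp ((a i \<omega>)\<^sup>2 / k\<^sup>2))" "(\<integral>\<omega>. exp ((a i \<omega>)\<^sup>2 / k\<^sup>2) \<partial>M) \<le> 2"
      using integral_le_if_nn_integral_le[of "\<lambda>\<omega>. exp ((a i \<omega>)\<^sup>2 / k\<^sup>2)" M 2] a[OF i] by auto
    have bi: "integrable M (\<lambda>\<omega>. exp ((b i \<omega>)\<^sup>2 / k\<^sup>2))" "(\<integral>\<omega>. exp ((b i \<omega>)\<^sup>2 / k\<^sup>2) \<partial>M) \<le> 2"
      using integral_le_if_nn_integral_le[of "\<lambda>\<omega>. exp ((b i \<omega>)\<^sup>2 / k\<^sup>2)" M 2] b[OF i] by auto
    show "integrable M (F i)" "integral\<^sup>L M (F i) \<le> 2"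
      unfolding F_def using ai bi by auto
  qed
  have pointwise: "exp (\<bar>\<Sum>i\<in>I. s i * (a i \<omega> * b i \<omega>)\<bar> / L) \<le> (\<Sum>i\<in>I. q i * F i \<omega>) + (1 - sum q I)" for \<omega>
  proof -
    let ?x = "\<lambda>i. ((a i \<omega>)\<^sup>2 / k\<^sup>2 + (b i \<omega>)\<^sup>2 / k\<^sup>2) / 2"
    have "\<bar>\<Sum>i\<in>I. s i * (a i \<omega> * b i \<omega>)\<bar> / L \<le> (\<Sum>i\<in>I. s i * (((a i \<omega>)\<^sup>2 + (b i \<omega>)\<^sup>2) / 2)) / L"
    proof (intro divide_right_mono order.trans[OF sum_abs] sum_mono)
      fix i assume "i \<in> I"
      have "\<bar>a i \<omega> * b i \<omega>\<bar> \<le> ((a i \<omega>)\<^sup>2 + (b i \<omega>)\<^sup>2) / 2"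
        using sum_squares_bound[of "\<bar>a i \<omega>\<bar>" "\<bar>b i \<omega>\<bar>"] by (simp add: abs_mult)
      then show "\<bar>s i * (a i \<omega> * b i \<omega>)\<bar> \<le> s i * (((a i \<omega>)\<^sup>2 + (b i \<omega>)\<^sup>2) / 2)"
        using s[OF \<open>i \<in> I\<close>] mult_left_mono by (fastforce simp: abs_mult[of "s i"])
    qed (use \<open>0 < L\<close> in simp)
    also have "\<dots> = (\<Sum>i\<in>I. q i * ?x i)"
      unfolding sum_divide_distrib
      using \<open>0 < k\<close> by (intro sum.cong) (simp_all add: q_def add_divide_distrib[symmetric])
    finally have "exp (\<bar>\<Sum>i\<in>I. s i * (a i \<omega> * b i \<omega>)\<bar> / L) \<le> exp (\<Sum>i\<in>I. q i * ?x i)" by simp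
    also have "\<dots> \<le> (\<Sum>i\<in>I. q i * exp (?x i)) + (1 - sum q I)"
      by (rule exp_subconvex_combination_le[OF q q1])
    also have "\<dots> \<le> (\<Sum>i\<in>I. q i * F i \<omega>) + (1 - sum q I)"
    proof (intro add_right_mono sum_mono mult_left_mono q)
      show "exp (?x i) \<le> F i \<omega>" for i
        using convex_onD[OF exp_convex, of "1/2" "(a i \<omega>)\<^sup>2 / k\<^sup>2" "(b i \<omega>)\<^sup>2 / k\<^sup>2"]
        by (simp add: F_def add_divide_distrib mult.commute)
    qed
    finally show ?thesis .
  qed
  have "(\<integral>\<^sup>+ \<omega>. ennreal (exp (\<bar>\<Sum>i\<in>I. s i * (a i \<omega> * b i \<omega>)\<bar> / L)) \<partial>M)
      \<le> (\<integral>\<^sup>+ \<omega>. ennreal ((\<Sum>i\<in>I. q i * F i \<omega>) + (1 - sum q I)) \<partial>M)"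
    by (intro nn_integral_mono ennreal_leI pointwise)
  also have "\<dots> = ennreal (\<integral>\<omega>. (\<Sum>i\<in>I. q i * F i \<omega>) + (1 - sum q I) \<partial>M)"
    using F(1) by (intro nn_integral_eq_integral AE_I2 order.trans[OF _ pointwise]) auto
  also have "(\<integral>\<omega>. (\<Sum>i\<in>I. q i * F i \<omega>) + (1 - sum q I) \<partial>M)
      = (\<Sum>i\<in>I. q i * integral\<^sup>L M (F i)) + (1 - sum q I)"
    using F(1) by (simp add: prob_space)
  also have "\<dots> \<le> (\<Sum>i\<in>I. q i * 2) + (1 - sum q I)"
    using F(2) q by (intro add_right_mono sum_mono mult_left_mono) auto
  also have "\<dots> \<le> 2" using q1 by (simp flip: sum_distrib_right)
  finally show ?thesis by (simp add: ennreal_leI)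
qed

text \<open>
  The constant is exactly 2: averaging \<open>1 + (z - ln 2) \<le> exp z / 2\<close> over \<open>z = |\<eta>| / L\<close> gives
  \<open>|E \<eta>| / L \<le> ln 2\<close>, so half of \<open>|\<eta> - E \<eta>| / L\<close> is at most the midpoint of \<open>|\<eta>| / L\<close> and \<open>ln 2\<close>, and
  convexity of \<open>exp\<close> bounds its exponential by the mean of two terms of expectation at most 2.
\<close>

lemma (in prob_space) centering_psi1_bound:
  fixes \<eta> :: "'a \<Rightarrow> real"
  assumes [measurable]: "\<eta> \<in> borel_measurable M" and "0 < L"
    and le: "(\<integral>\<^sup>+ \<omega>. ennreal (exp (\<bar>\<eta> \<omega>\<bar> / L)) \<partial>M) \<le> 2"
  shows "integrable M \<eta>"
    and "(\<integral>\<^sup>+ \<omega>. ennreal (exp (\<bar>\<eta> \<omega> - expectation \<eta>\<bar> / (2 * L))) \<partial>M) \<le> 2"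
proof -
  define X where "X \<omega> = \<bar>\<eta> \<omega>\<bar> / L" for \<omega>
  have [measurable]: "X \<in> borel_measurable M" unfolding X_def by measurable
  have E: "integrable M (\<lambda>\<omega>. exp (X \<omega>))" "expectation (\<lambda>\<omega>. exp (X \<omega>)) \<le> 2"
    using integral_le_if_nn_integral_le[of "\<lambda>\<omega>. exp (X \<omega>)" M 2] le by (auto simp: X_def)
  have X_le: "\<bar>X \<omega>\<bar> \<le> exp (X \<omega>)" for \<omega>
  proof -
    have "0 \<le> X \<omega>" using \<open>0 < L\<close> by (simp add: X_def)
    then show ?thesis using exp_ge_add_one_self[of "X \<omega>"] by linarith
  qed
  have X_int: "integrable M X"
    by (rule Bochner_Integration.integrable_bound[OF E(1)]) (use X_le in auto)
  then have abs_int: "integrable M (\<lambda>\<omega>. \<bar>\<eta> \<omega>\<bar>)"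
    using integrable_mult_right[of L M X] \<open>0 < L\<close> by (simp add: X_def)
  then show "integrable M \<eta>" by (simp add: integrable_abs_iff)
  have "expectation (\<lambda>\<omega>. 1 + (X \<omega> - ln 2)) \<le> expectation (\<lambda>\<omega>. exp (X \<omega>) / 2)"
  proof (rule integral_mono)
    show "1 + (X \<omega> - ln 2) \<le> exp (X \<omega>) / 2" for \<omega>
      using exp_ge_add_one_self[of "X \<omega> - ln 2"] by (simp add: exp_diff)
  qed (use X_int E(1) in auto)
  then have "expectation X \<le> ln 2" using E X_int by (simp add: prob_space)
  moreover have "\<bar>expectation \<eta>\<bar> / L \<le> expectation X"
  proof -
    have "expectation X = expectation (\<lambda>\<omega>. \<bar>\<eta> \<omega>\<bar>) / L" by (simp add: X_def[abs_def])
    then show ?thesis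
      using integral_abs_bound[of M \<eta>] \<open>0 < L\<close> by (simp add: divide_right_mono)
  qed
  ultimately have mean: "\<bar>expectation \<eta>\<bar> / L \<le> ln 2" by simp
  have pointwise: "exp (\<bar>\<eta> \<omega> - expectation \<eta>\<bar> / (2 * L)) \<le> exp (X \<omega>) / 2 + 1" for \<omega>
  proof -
    have "\<bar>\<eta> \<omega> - expectation \<eta>\<bar> / (2 * L) \<le> (\<bar>\<eta> \<omega>\<bar> + \<bar>expectation \<eta>\<bar>) / (2 * L)"
      using \<open>0 < L\<close> by (intro divide_right_mono) auto
    also have "\<dots> = (X \<omega> + \<bar>expectation \<eta>\<bar> / L) / 2"
      using \<open>0 < L\<close> by (simp add: X_def field_simps)
    also have "\<dots> \<le> (X \<omega> + ln 2) / 2" using mean by (intro divide_right_mono add_left_mono) auto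
    finally have "exp (\<bar>\<eta> \<omega> - expectation \<eta>\<bar> / (2 * L)) \<le> exp ((X \<omega> + ln 2) / 2)" by simp
    also have "\<dots> \<le> (exp (X \<omega>) + exp (ln 2)) / 2"
      using convex_onD[OF exp_convex, of "1/2" "X \<omega>" "ln 2"] by (simp add: add_divide_distrib)
    finally show ?thesis by (simp add: add_divide_distrib)
  qed
  have "(\<integral>\<^sup>+ \<omega>. ennreal (exp (\<bar>\<eta> \<omega> - expectation \<eta>\<bar> / (2 * L))) \<partial>M)
      \<le> (\<integral>\<^sup>+ \<omega>. ennreal (exp (X \<omega>) / 2 + 1) \<partial>M)"
    by (intro nn_integral_mono ennreal_leI pointwise)
  also have "\<dots> = ennreal (expectation (\<lambda>\<omega>. exp (X \<omega>) / 2 + 1))"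
    using E(1) by (intro nn_integral_eq_integral) auto
  also have "expectation (\<lambda>\<omega>. exp (X \<omega>) / 2 + 1) \<le> 2"
    using E by (simp add: prob_space)
  finally show "(\<integral>\<^sup>+ \<omega>. ennreal (exp (\<bar>\<eta> \<omega> - expectation \<eta>\<bar> / (2 * L))) \<partial>M) \<le> 2"
    by (simp add: ennreal_leI)
qed

text \<open>
  Integrability and the bound are obtained with \<open>K + \<epsilon>\<close> in place of \<open>K\<close>, where the exponential
  moments of the marginals are known, and with an extra \<open>\<epsilon>\<close> that keeps the scale \<open>L\<close> positive even if
  \<open>A = 0\<close> or \<open>K = 0\<close>; then \<open>\<epsilon>\<close> tends to 0.
\<close>

lemma psi1_norm_centered_quadratic_form:
  fixes \<xi> :: "'a \<Rightarrow> real ^ 'n" and A :: "real ^ 'n ^ 'n"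
  assumes "prob_space M" and \<xi>: "\<xi> \<in> borel_measurable M" and K: "psi2_vec_norm M \<xi> \<le> ereal K"
  shows "integrable M (\<lambda>\<omega>. (A *v \<xi> \<omega>) \<bullet> \<xi> \<omega>)"
    and "psi1_norm M (\<lambda>\<omega>. (A *v \<xi> \<omega>) \<bullet> \<xi> \<omega> - (\<integral>\<omega>'. (A *v \<xi> \<omega>') \<bullet> \<xi> \<omega>' \<partial>M))
           \<le> ereal (2 * trace_norm A * K\<^sup>2)"
proof -
  interpret prob_space M by fact
  note [measurable] = \<xi>
  obtain W :: "(real ^ 'n) set" and s v where W: "finite W" "\<And>w. w \<in> W \<Longrightarrow> norm w = 1"
    "\<And>w. norm (v w) = 1" "\<And>w. 0 \<le> s w" "trace_norm A = (\<Sum>w\<in>W. s w)"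
    and dec: "\<And>x. (A *v x) \<bullet> x = (\<Sum>w\<in>W. s w * ((x \<bullet> w) * (x \<bullet> v w)))"
    by (rule trace_norm_bilinear_decomposition[of A]) (rule that)
  define \<eta> where "\<eta> = (\<lambda>\<omega>. (A *v \<xi> \<omega>) \<bullet> \<xi> \<omega>)"
  have [measurable]: "\<eta> \<in> borel_measurable M" unfolding \<eta>_def dec by measurable
  have \<eta>: "integrable M \<eta>"
    "psi1_norm M (\<lambda>\<omega>. \<eta> \<omega> - expectation \<eta>) \<le> ereal (2 * (trace_norm A * (K + \<epsilon>)\<^sup>2 + \<epsilon>))"
    if "0 < \<epsilon>" for \<epsilon>
  proof -
    define k where "k = K + \<epsilon>"
    have less: "psi2_vec_norm M \<xi> < ereal k"
      using K by (rule order_le_less_trans) (simp add: k_def \<open>0 < \<epsilon>\<close>)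
    have "0 < k" using psi2_vec_norm_lessD(1)[OF less W(3)] .
    define L where "L = trace_norm A * k\<^sup>2 + \<epsilon>"
    have "0 \<le> trace_norm A" using W by (simp add: sum_nonneg)
    then have "0 < L" using \<open>0 < \<epsilon>\<close> by (simp add: L_def add_nonneg_pos)
    have "(\<integral>\<^sup>+ \<omega>. ennreal (exp (\<bar>\<eta> \<omega>\<bar> / L)) \<partial>M) \<le> 2"
      unfolding \<eta>_def dec
      by (rule sum_of_products_psi1_bound[where k = k])
         (use W \<open>0 < k\<close> \<open>0 < L\<close> \<open>0 < \<epsilon>\<close> in \<open>auto simp: L_def intro!: psi2_vec_norm_lessD(2)[OF less]\<close>)
    note c = centering_psi1_bound[OF _ \<open>0 < L\<close> this]
    show "integrable M \<eta>" by (rule c(1)) simp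
    show "psi1_norm M (\<lambda>\<omega>. \<eta> \<omega> - expectation \<eta>) \<le> ereal (2 * (trace_norm A * (K + \<epsilon>)\<^sup>2 + \<epsilon>))"
      using psi1_norm_leI[OF _ c(2)] \<open>0 < L\<close> by (simp add: L_def k_def)
  qed
  show "integrable M (\<lambda>\<omega>. (A *v \<xi> \<omega>) \<bullet> \<xi> \<omega>)" using \<eta>(1)[of 1] by (simp add: \<eta>_def)
  have "((\<lambda>\<epsilon>. ereal (2 * (trace_norm A * (K + \<epsilon>)\<^sup>2 + \<epsilon>))) \<longlongrightarrow> ereal (2 * (trace_norm A * (K + 0)\<^sup>2 + 0)))
          (at_right 0)"
    by (intro tendsto_intros)
  then have "psi1_norm M (\<lambda>\<omega>. \<eta> \<omega> - expectation \<eta>) \<le> ereal (2 * (trace_norm A * (K + 0)\<^sup>2 + 0))"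
  proof (rule tendsto_lowerbound)
    show "\<forall>\<^sub>F \<epsilon> in at_right 0. psi1_norm M (\<lambda>\<omega>. \<eta> \<omega> - expectation \<eta>)
            \<le> ereal (2 * (trace_norm A * (K + \<epsilon>)\<^sup>2 + \<epsilon>))"
      using eventually_at_right_less by (rule eventually_mono) (rule \<eta>(2))
  qed simp
  then show "psi1_norm M (\<lambda>\<omega>. (A *v \<xi> \<omega>) \<bullet> \<xi> \<omega> - (\<integral>\<omega>'. (A *v \<xi> \<omega>') \<bullet> \<xi> \<omega>' \<partial>M))
           \<le> ereal (2 * trace_norm A * K\<^sup>2)"
    by (simp add: \<eta>_def mult.assoc)
qed

section \<open>Tail bounds for sub-exponential variables\<close>

text \<open>
  Replacing the norm by an upper bound \<open>B\<close> weakens the bound on the moment generating function and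
  shrinks the range of admissible \<open>l\<close>. That range is written without division, so that \<open>B = 0\<close> admits
  every \<open>l > 0\<close>.
\<close>

lemma sub_exponential_chernoff:
  fixes M :: "'a measure"
  assumes C: "sub_exponential_mgf_constant TYPE('a) C" and "prob_space M"
    and sub: "sub_exponential M \<eta>" and cen: "centered M \<eta>"
    and B: "psi1_norm M \<eta> \<le> ereal B" and "0 < l" and l: "l * (C * B) \<le> 1"
  shows "measure M {\<omega> \<in> space M. t \<le> \<bar>\<eta> \<omega>\<bar>} \<le> 2 * exp (C\<^sup>2 * B\<^sup>2 * l\<^sup>2 - l * t)"
proof -
  interpret prob_space M by fact
  have [measurable]: "\<eta> \<in> borel_measurable M" using sub by (simp add: sub_exponential_def)
  have "0 < C" using C by (simp add: sub_exponential_mgf_constant_def)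
  obtain N where N: "psi1_norm M \<eta> = ereal N" "0 \<le> N" "N \<le> B"
    using B psi1_norm_nonneg[of M \<eta>] by (cases "psi1_norm M \<eta>") auto
  have "l * (C * N) \<le> 1"
    using l N \<open>0 < C\<close> \<open>0 < l\<close> by (smt (verit) mult_left_mono mult_nonneg_nonneg)
  then have adm: "ereal l \<le> 1 / (ereal C * psi1_norm M \<eta>)"
    using N \<open>0 < C\<close> by (cases "N = 0") (auto simp: one_ereal_def pos_le_divide_eq ereal_divide)
  have "C\<^sup>2 * N\<^sup>2 * l\<^sup>2 \<le> C\<^sup>2 * B\<^sup>2 * l\<^sup>2"
    using N by (intro mult_right_mono mult_left_mono power_mono) auto
  moreover have mgf0: "(\<integral>\<^sup>+ \<omega>. ennreal (exp (r * \<eta> \<omega>)) \<partial>M) \<le> ennreal (exp (C\<^sup>2 * N\<^sup>2 * r\<^sup>2))"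
    if "\<bar>r\<bar> = l" for r
    using C \<open>prob_space M\<close> sub cen adm N(1) that
    unfolding sub_exponential_mgf_constant_def by (metis real_of_ereal.simps(1))
  ultimately have mgf: "(\<integral>\<^sup>+ \<omega>. ennreal (exp (r * \<eta> \<omega>)) \<partial>M) \<le> ennreal (exp (C\<^sup>2 * B\<^sup>2 * l\<^sup>2))"
    if "\<bar>r\<bar> = l" for r
    using that by (intro order.trans[OF mgf0[OF that]] ennreal_leI) (auto simp flip: power2_abs[of r])
  have one_sided: "measure M {\<omega> \<in> space M. t \<le> \<sigma> * \<eta> \<omega>} \<le> exp (C\<^sup>2 * B\<^sup>2 * l\<^sup>2 - l * t)"
    if "\<bar>\<sigma>\<bar> = 1" for \<sigma> :: real
  proof -
    have "emeasure M {\<omega> \<in> space M. t \<le> \<sigma> * \<eta> \<omega>}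
        \<le> ennreal (exp (- l * t)) * (\<integral>\<^sup>+ \<omega>. ennreal (exp (l * (\<sigma> * \<eta> \<omega>))) * indicator (space M) \<omega> \<partial>M)"
      by (rule Chernoff_ineq_nn_integral_ge[OF \<open>0 < l\<close>]) auto
    also have "(\<integral>\<^sup>+ \<omega>. ennreal (exp (l * (\<sigma> * \<eta> \<omega>))) * indicator (space M) \<omega> \<partial>M)
        = (\<integral>\<^sup>+ \<omega>. ennreal (exp ((l * \<sigma>) * \<eta> \<omega>)) \<partial>M)"
      by (intro nn_integral_cong) (simp add: mult.assoc)
    also have "\<dots> \<le> ennreal (exp (C\<^sup>2 * B\<^sup>2 * l\<^sup>2))"
      using \<open>0 < l\<close> that by (intro mgf) (simp add: abs_mult)
    finally have "emeasure M {\<omega> \<in> space M. t \<le> \<sigma> * \<eta> \<omega>}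
        \<le> ennreal (exp (- l * t)) * ennreal (exp (C\<^sup>2 * B\<^sup>2 * l\<^sup>2))"
      by (simp add: mult_left_mono)
    also have "\<dots> = ennreal (exp (C\<^sup>2 * B\<^sup>2 * l\<^sup>2 - l * t))"
      by (simp add: exp_diff exp_minus field_simps flip: ennreal_mult)
    finally show ?thesis by (simp add: emeasure_eq_measure)
  qed
  have "{\<omega> \<in> space M. t \<le> \<bar>\<eta> \<omega>\<bar>}
      = {\<omega> \<in> space M. t \<le> 1 * \<eta> \<omega>} \<union> {\<omega> \<in> space M. t \<le> (-1) * \<eta> \<omega>}" by auto
  also have "measure M \<dots> \<le> measure M {\<omega> \<in> space M. t \<le> 1 * \<eta> \<omega>}
      + measure M {\<omega> \<in> space M. t \<le> (-1) * \<eta> \<omega>}"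
    by (intro measure_Un_le) measurable
  also have "\<dots> \<le> 2 * exp (C\<^sup>2 * B\<^sup>2 * l\<^sup>2 - l * t)"
    using one_sided[of 1] one_sided[of "-1"] by simp
  finally show ?thesis .
qed

text \<open>
  For \<open>B > 0\<close> the Chernoff exponent \<open>C\<^sup>2 B\<^sup>2 l\<^sup>2 - l t\<close> is minimal at \<open>l = t / (2 C\<^sup>2 B\<^sup>2)\<close>. This is
  admissible, that is \<open>l \<le> 1 / (C B)\<close>, iff \<open>t \<le> 2 C B\<close>, and gives the Gaussian term. Otherwise
  \<open>l = 1 / (C B)\<close> has exponent \<open>1 - t / (C B) \<le> - t / (2 C B)\<close>. For \<open>B = 0\<close> every \<open>l > 0\<close> is admissible
  and \<open>l \<rightarrow> \<infinity>\<close> shows that the tail is 0, which is how the right-hand side reads.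
\<close>

lemma sub_exponential_tail:
  fixes M :: "'a measure"
  assumes C: "sub_exponential_mgf_constant TYPE('a) C" and "prob_space M"
    and sub: "sub_exponential M \<eta>" and cen: "centered M \<eta>"
    and B: "psi1_norm M \<eta> \<le> ereal B" and "0 < t"
  shows "ereal (measure M {\<omega> \<in> space M. t \<le> \<bar>\<eta> \<omega>\<bar>})
           \<le> 2 * exp_ereal (- min (ereal (t\<^sup>2) / ereal (4 * C\<^sup>2 * B\<^sup>2)) (ereal t / ereal (2 * C * B)))"
proof -
  interpret prob_space M by fact
  note chernoff = sub_exponential_chernoff[OF C \<open>prob_space M\<close> sub cen B]
  have "0 < C" using C by (simp add: sub_exponential_mgf_constant_def)
  have "0 \<le> B" using order.trans[OF psi1_norm_nonneg B] by simp
  then consider "B = 0" | "0 < B" "t \<le> 2 * C * B" | "0 < B" "2 * C * B < t" by force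
  then show ?thesis
  proof cases
    case 1
    have "((\<lambda>l. 2 * exp (- (l * t))) \<longlongrightarrow> 0) at_top"
      using \<open>0 < t\<close>
      by (intro tendsto_mult_right_zero filterlim_compose[OF exp_at_bot]
          filterlim_compose[OF filterlim_uminus_at_bot_at_top]
          filterlim_at_top_mult_tendsto_pos[OF tendsto_const] filterlim_ident)
    then have "measure M {\<omega> \<in> space M. t \<le> \<bar>\<eta> \<omega>\<bar>} \<le> 0"
    proof (rule tendsto_lowerbound)
      show "\<forall>\<^sub>F l in at_top. measure M {\<omega> \<in> space M. t \<le> \<bar>\<eta> \<omega>\<bar>} \<le> 2 * exp (- (l * t))"
        using eventually_gt_at_top[of 0] by eventually_elim (use chernoff[where t = t] 1 in simp)
    qed simp
    moreover have "ereal x / ereal 0 = \<infinity>" if "0 < x" for x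
      using that by (simp add: zero_ereal_def[symmetric] divide_ereal_def)
    moreover have "exp_ereal (- \<infinity>) = 0" using exp_ereal.simps(3) by simp
    ultimately show ?thesis using 1 \<open>0 < t\<close> by simp
  next
    case 2
    have "measure M {\<omega> \<in> space M. t \<le> \<bar>\<eta> \<omega>\<bar>} \<le> 2 * exp (- (t\<^sup>2 / (4 * C\<^sup>2 * B\<^sup>2)))"
    proof -
      let ?l = "t / (2 * C\<^sup>2 * B\<^sup>2)"
      have "0 < ?l" "?l * (C * B) \<le> 1"
        using 2 \<open>0 < C\<close> \<open>0 < t\<close> by (simp_all add: power2_eq_square field_simps)
      moreover have "C\<^sup>2 * B\<^sup>2 * ?l\<^sup>2 - ?l * t = - (t\<^sup>2 / (4 * C\<^sup>2 * B\<^sup>2))"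
        using 2 \<open>0 < C\<close> by (simp add: power2_eq_square field_simps)
      ultimately show ?thesis using chernoff[of ?l t] by simp
    qed
    also have "\<dots> \<le> 2 * exp (- min (t\<^sup>2 / (4 * C\<^sup>2 * B\<^sup>2)) (t / (2 * C * B)))" by simp
    finally show ?thesis using 2 \<open>0 < C\<close> by (simp flip: ereal_min)
  next
    case 3
    have "measure M {\<omega> \<in> space M. t \<le> \<bar>\<eta> \<omega>\<bar>} \<le> 2 * exp (- (t / (2 * C * B)))"
    proof -
      let ?l = "1 / (C * B)"
      have "0 < ?l" "?l * (C * B) \<le> 1" using 3 \<open>0 < C\<close> by simp_all
      note chernoff[OF this, of t]
      also have "C\<^sup>2 * B\<^sup>2 * ?l\<^sup>2 - ?l * t \<le> - (t / (2 * C * B))"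
        using 3 \<open>0 < C\<close> by (simp add: power2_eq_square field_simps)
      finally show ?thesis by simp
    qed
    also have "\<dots> \<le> 2 * exp (- min (t\<^sup>2 / (4 * C\<^sup>2 * B\<^sup>2)) (t / (2 * C * B)))" by simp
    finally show ?thesis using 3 \<open>0 < C\<close> by (simp flip: ereal_min)
  qed
qed

section \<open>Concentration of the quadratic form\<close>

theorem corollary2p5:
  fixes M :: "'a measure"
    and \<xi> :: "'a \<Rightarrow> real ^ 'n"
    and A :: "real ^ 'n ^ 'n"
    and C\<^sub>1 K t :: real
  assumes "sub_exponential_mgf_constant TYPE('a) C\<^sub>1"
    and "prob_space M"
    and "\<xi> \<in> L_psi2 M"
    and "psi2_vec_norm M \<xi> \<le> ereal K"
    and "0 \<le> t"
  shows "ereal (measure M {\<omega> \<in> space M.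
             \<bar>(A *v \<xi> \<omega>) \<bullet> \<xi> \<omega> - (\<integral>\<omega>'. (A *v \<xi> \<omega>') \<bullet> \<xi> \<omega>' \<partial>M)\<bar> \<ge> t})
         \<le> 2 * exp_ereal (- min
               (ereal (t\<^sup>2) / ereal (16 * C\<^sub>1\<^sup>2 * (trace_norm A)\<^sup>2 * K ^ 4))
               (ereal t / ereal (4 * C\<^sub>1 * trace_norm A * K\<^sup>2)))"
proof -
  interpret prob_space M by fact
  let ?\<eta> = "\<lambda>\<omega>. (A *v \<xi> \<omega>) \<bullet> \<xi> \<omega> - (\<integral>\<omega>'. (A *v \<xi> \<omega>') \<bullet> \<xi> \<omega>' \<partial>M)"
  define B where "B = 2 * trace_norm A * K\<^sup>2"
  have \<xi>: "\<xi> \<in> borel_measurable M" using assms(3) by (simp add: L_psi2_def)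
  have int: "integrable M (\<lambda>\<omega>. (A *v \<xi> \<omega>) \<bullet> \<xi> \<omega>)" and B: "psi1_norm M ?\<eta> \<le> ereal B"
    using psi1_norm_centered_quadratic_form[OF assms(2) \<xi> assms(4), of A] by (auto simp: B_def)
  have scales: "16 * C\<^sub>1\<^sup>2 * (trace_norm A)\<^sup>2 * K ^ 4 = 4 * C\<^sub>1\<^sup>2 * B\<^sup>2"
    "4 * C\<^sub>1 * trace_norm A * K\<^sup>2 = 2 * C\<^sub>1 * B"
    by (simp_all add: B_def power_mult_distrib flip: power_mult)
  show ?thesis
  proof (cases "t = 0")
    case True
    \<comment> \<open>Here \<open>0 / 0 = 0\<close> in the extended reals makes the bound 2 even for vanishing denominators.\<close>
    have rhs: "2 * exp_ereal (- min (ereal (t\<^sup>2) / ereal x) (ereal t / ereal y)) = ereal 2" for x y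
    proof -
      have "ereal 0 / ereal z = ereal 0" for z by (cases "z = 0") simp_all
      then show ?thesis using True by simp
    qed
    show ?thesis
      unfolding rhs using prob_le_1 by (simp add: order.trans[OF prob_le_1])
  next
    case False
    have "sub_exponential M ?\<eta>"
      using int order_le_less_trans[OF B, of \<infinity>] by (auto simp: sub_exponential_def)
    moreover have "centered M ?\<eta>"
      using int by (simp add: centered_def prob_space)
    ultimately show ?thesis
      unfolding scales using False assms(1,2,5) B by (intro sub_exponential_tail) auto
  qed
qed

end
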